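(* For the generalized Nash equilibrium problem (GNEP) with quasi-linear constraints in which player $i$ ($i=1,\ldots,N$) solves $$\mathrm{F}_i(x_{-i}):\quad \min_{x_i\in\mathbb{R}^{n_i}} f_i(x_i,x_{-i})\quad \text{s.t.}\quad A_ix_i-b_i(x_{-i})\ge 0,$$ the KKT set $\mathcal{K}$ can be expressed as $$\mathcal{K}=\bigcup_{J\in\mathcal{P}}\mathcal{K}_J .$$
   Context: There are $N$ players; player $i$'s strategy is $x_i\in\mathbb{R}^{n_i}$, $x=(x_1,\ldots,x_N)\in\mathbb{R}^n$ with $n=n_1+\cdots+n_N$, and $x_{-i}$ denotes $x$ with $x_i$ removed, so $x=(x_i,x_{-i})$. Each $f_i$ is a real polynomial in $x$, each $A_i\in\mathbb{R}^{m_i\times n_i}$ is a constant matrix with rows $a_{i,1}^T,\ldots,a_{i,m_i}^T$, and $b_i(x_{-i})$ is a vector of $m_i$ real polynomials in $x_{-i}$. Write $[m]=\{1,\ldots,m\}$. The feasible set is $X=\{x: A_ix_i-b_i(x_{-i})\ge 0 \text{ for all } i\in[N]\}$. For vectors $u,v$ of equal length, $0\le u\perp v\ge 0$ means $u\ge0$, $v\ge 0$ entrywise and $u^Tv=0$. The KKT set is $$\mathcal{K}=\{x\in X:\ \exists\,\lambda_i\in\mathbb{R}^{m_i}\ (i\in[N])\text{ such that for every }i:\ \nabla_{x_i}f_i(x)-A_i^T\lambda_i=0,\ 0\le\lambda_i\perp (A_ix_i-b_i(x_{-i}))\ge 0\}.$$ Let $r_i=\operatorname{rank}A_i$. For $J_i\subseteq[m_i]$,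 $A_{i,J_i}$ and $b_{i,J_i}$ denote the submatrix of $A_i$ and subvector of $b_i$ with rows labelled by $J_i$. Let $$\mathcal{P}_i=\{J_i\subseteq[m_i]:\ |J_i|=r_i,\ \operatorname{rank}A_{i,J_i}=r_i\},\qquad \mathcal{P}=\mathcal{P}_1\times\cdots\times\mathcal{P}_N.$$ For $J_i\in\mathcal{P}_i$ the partial Lagrange multiplier expression is $$\lambda_{i,J_i}(x)=(A_{i,J_i}A_{i,J_i}^T)^{-1}A_{i,J_i}\nabla_{x_i}f_i(x).$$ For $J=(J_1,\ldots,J_N)\in\mathcal{P}$, $$\mathcal{K}_J=\{x\in X:\ \nabla_{x_i}f_i(x)-A_{i,J_i}^T\lambda_{i,J_i}(x)=0,\ 0\le\lambda_{i,J_i}(x)\perp(A_{i,J_i}x_i-b_{i,J_i}(x_{-i}))\ge0,\ \text{for all } i=1,\ldots,N\}.$$ *)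

theory Defs
  imports
    "HOL-Analysis.Derivative"
    "HOL-Library.FuncSet"
    "HOL-Library.Poly_Mapping"
    "Jordan_Normal_Form.DL_Rank"
    "Jordan_Normal_Form.DL_Submatrix"
    "Jordan_Normal_Form.Gauss_Jordan_Elimination"
begin

text \<open>
  Players are \<open>0, \<dots>, N - 1\<close>, and player \<open>i\<close> has strategies in \<open>carrier_vec (n i)\<close>.
  The variable \<open>(j, k)\<close> stands for the \<open>k\<close>-th coordinate of \<open>x\<^sub>j\<close>. A polynomial maps
  monomials, i.e. exponent functions of finite support, to their coefficients.
\<close>

type_synonym poly_var = "nat \<times> nat"
type_synonym real_mpoly = "(poly_var \<Rightarrow>\<^sub>0 nat) \<Rightarrow>\<^sub>0 real"
type_synonym profile = "nat \<Rightarrow> real vec"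

definition poly_vars :: "real_mpoly \<Rightarrow> poly_var set" where
  "poly_vars p = (\<Union>e\<in>Poly_Mapping.keys p. Poly_Mapping.keys e)"

definition poly_eval :: "real_mpoly \<Rightarrow> (poly_var \<Rightarrow> real) \<Rightarrow> real" where
  "poly_eval p v = (\<Sum>e\<in>Poly_Mapping.keys p. Poly_Mapping.lookup p e * (\<Prod>z\<in>Poly_Mapping.keys e. v z ^ Poly_Mapping.lookup e z))"

definition coords :: "profile \<Rightarrow> poly_var \<Rightarrow> real" where
  "coords x = (\<lambda>(j, k). x j $ k)"

text \<open>Profiles are extensional, so that distinct functions are distinct points of
  \<open>\<real>\<^bsup>n\<^sub>0 + \<dots> + n\<^sub>N\<^sub>-\<^sub>1\<^esup>\<close>.\<close>

definition profiles :: "nat \<Rightarrow> (nat \<Rightarrow> nat) \<Rightarrow> profile set" where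
  "profiles N n = (\<Pi>\<^sub>E i\<in>{..<N}. carrier_vec (n i))"

definition block_vars :: "nat set \<Rightarrow> (nat \<Rightarrow> nat) \<Rightarrow> poly_var set" where
  "block_vars I n = (SIGMA j:I. {..<n j})"

definition block_gradient :: "nat \<Rightarrow> nat \<Rightarrow> real_mpoly \<Rightarrow> profile \<Rightarrow> real vec" where
  "block_gradient i d p x =
     vec d (\<lambda>k. deriv (\<lambda>t. poly_eval p ((coords x)((i, k) := t))) (x i $ k))"

lemma poly_eval_coordinate_differentiable:
  "(\<lambda>t. poly_eval p (v(z := t))) differentiable (at t0)"
proof -
  have factor: "(\<lambda>t. (v(z := t)) y ^ d) differentiable (at t0)" for y d
    by (cases "y = z") simp_all
  have "(\<lambda>t. \<Prod>y\<in>S. (v(z := t)) y ^ Poly_Mapping.lookup e y) differentiable (at t0)"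
    if "finite S" for S and e :: "poly_var \<Rightarrow>\<^sub>0 nat"
    using that
  proof (induction S)
    case (insert y S)
    then show ?case
      using differentiable_mult[OF factor insert.IH] by simp
  qed simp
  then show ?thesis
    unfolding poly_eval_def
    by (intro differentiable_sum ballI differentiable_mult) simp_all
qed

definition constraint_vec ::
    "(nat \<Rightarrow> real mat) \<Rightarrow> (nat \<Rightarrow> real_mpoly vec) \<Rightarrow> nat \<Rightarrow> profile \<Rightarrow> real vec" where
  "constraint_vec A b i x = A i *\<^sub>v x i - map_vec (\<lambda>p. poly_eval p (coords x)) (b i)"

text \<open>The order on vectors is entrywise and includes equality of dimensions.\<close>

definition complementary :: "real vec \<Rightarrow> real vec \<Rightarrow> bool" where
  "complementary u v \<longleftrightarrow> 0\<^sub>v (dim_vec u) \<le> u \<and> 0\<^sub>v (dim_vec u) \<le> v \<and> scalar_prod u v = 0"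

definition feasible_set ::
    "nat \<Rightarrow> (nat \<Rightarrow> nat) \<Rightarrow> (nat \<Rightarrow> nat) \<Rightarrow> (nat \<Rightarrow> real mat) \<Rightarrow> (nat \<Rightarrow> real_mpoly vec)
      \<Rightarrow> profile set" where
  "feasible_set N n m A b =
     {x \<in> profiles N n. \<forall>i<N. 0\<^sub>v (m i) \<le> constraint_vec A b i x}"

definition KKT_set ::
    "nat \<Rightarrow> (nat \<Rightarrow> nat) \<Rightarrow> (nat \<Rightarrow> nat) \<Rightarrow> (nat \<Rightarrow> real_mpoly) \<Rightarrow> (nat \<Rightarrow> real mat)
      \<Rightarrow> (nat \<Rightarrow> real_mpoly vec) \<Rightarrow> profile set" where
  "KKT_set N n m f A b =
     {x \<in> feasible_set N n m A b. \<exists>l :: nat \<Rightarrow> real vec. \<forall>i<N.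
        l i \<in> carrier_vec (m i) \<and>
        block_gradient i (n i) (f i) x - (A i)\<^sup>T *\<^sub>v l i = 0\<^sub>v (n i) \<and>
        complementary (l i) (constraint_vec A b i x)}"

definition mat_rank :: "real mat \<Rightarrow> nat" where
  "mat_rank M = vec_space.rank (dim_row M) M"

definition row_submat :: "real mat \<Rightarrow> nat set \<Rightarrow> real mat" where
  "row_submat M J = submatrix M J UNIV"

text \<open>As in \<^const>\<open>submatrix\<close>, \<open>pick J k\<close> is the \<open>k\<close>-th smallest element of \<open>J\<close>, counting from 0.\<close>

definition subvec :: "'a vec \<Rightarrow> nat set \<Rightarrow> 'a vec" where
  "subvec v J = vec (card {k. k < dim_vec v \<and> k \<in> J}) (\<lambda>k. v $ pick J k)"

definition row_bases :: "(nat \<Rightarrow> nat) \<Rightarrow> (nat \<Rightarrow> real mat) \<Rightarrow> nat \<Rightarrow> nat set set" where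
  "row_bases m A i =
     {J. J \<subseteq> {..<m i} \<and> card J = mat_rank (A i) \<and> mat_rank (row_submat (A i) J) = mat_rank (A i)}"

definition row_basis_tuples ::
    "nat \<Rightarrow> (nat \<Rightarrow> nat) \<Rightarrow> (nat \<Rightarrow> real mat) \<Rightarrow> (nat \<Rightarrow> nat set) set" where
  "row_basis_tuples N m A = (\<Pi>\<^sub>E i\<in>{..<N}. row_bases m A i)"

text \<open>\<open>mat_inverse\<close> returns an option; for \<open>J \<in> row_bases m A i\<close> the Gram matrix below is
  invertible, so \<open>the\<close> yields its inverse.\<close>

definition partial_LME ::
    "(nat \<Rightarrow> nat) \<Rightarrow> (nat \<Rightarrow> real_mpoly) \<Rightarrow> (nat \<Rightarrow> real mat) \<Rightarrow> nat \<Rightarrow> nat set \<Rightarrow> profile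
      \<Rightarrow> real vec" where
  "partial_LME n f A i J x =
     (let B = row_submat (A i) J
      in the (mat_inverse (B * B\<^sup>T)) *\<^sub>v (B *\<^sub>v block_gradient i (n i) (f i) x))"

definition partial_constraint_vec ::
    "(nat \<Rightarrow> real mat) \<Rightarrow> (nat \<Rightarrow> real_mpoly vec) \<Rightarrow> nat \<Rightarrow> nat set \<Rightarrow> profile \<Rightarrow> real vec" where
  "partial_constraint_vec A b i J x =
     row_submat (A i) J *\<^sub>v x i - map_vec (\<lambda>p. poly_eval p (coords x)) (subvec (b i) J)"

definition partial_KKT_set ::
    "nat \<Rightarrow> (nat \<Rightarrow> nat) \<Rightarrow> (nat \<Rightarrow> nat) \<Rightarrow> (nat \<Rightarrow> real_mpoly) \<Rightarrow> (nat \<Rightarrow> real mat)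
      \<Rightarrow> (nat \<Rightarrow> real_mpoly vec) \<Rightarrow> (nat \<Rightarrow> nat set) \<Rightarrow> profile set" where
  "partial_KKT_set N n m f A b J =
     {x \<in> feasible_set N n m A b. \<forall>i<N.
        block_gradient i (n i) (f i) x
          - (row_submat (A i) (J i))\<^sup>T *\<^sub>v partial_LME n f A i (J i) x = 0\<^sub>v (n i) \<and>
        complementary (partial_LME n f A i (J i) x) (partial_constraint_vec A b i (J i) x)}"

end

theory Submission
  imports Defs
begin

text \<open>
  By Caratheodory's theorem for cones, a KKT multiplier can be chosen such that the rows of
  \<open>A\<^sub>i\<close> in its support are linearly independent; these extend to a row basis \<open>J\<^sub>i\<close>, and on
  independent rows the multiplier is determined by the gradient through the Gram matrix, so it
  equals the partial multiplier expression. Conversely, a partial multiplier padded with zeros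
  is a KKT multiplier. Ranks are column ranks here: if \<open>A = C B\<close>, where \<open>B\<close> consists of \<open>k\<close> rows
  of \<open>A\<close>, \<open>C\<close> has a left inverse and \<open>B\<close> a right inverse, then \<open>A\<close> and \<open>C\<close> have the same
  column space, which has dimension \<open>k\<close>.
\<close>

section \<open>Selection matrices and padding with zeros\<close>

text \<open>Left multiplication by \<open>selection m J\<close> extracts the rows in \<open>J\<close>; its transpose pads with
  zeros outside \<open>J\<close>.\<close>

definition selection :: "nat \<Rightarrow> nat set \<Rightarrow> real mat" where
  "selection m J = mat (card J) m (\<lambda>(k, j). if j = pick J k then 1 else 0)"

definition supported :: "real vec \<Rightarrow> nat set \<Rightarrow> bool" where
  "supported v J \<longleftrightarrow> (\<forall>j<dim_vec v. j \<notin> J \<longrightarrow> v $ j = 0)"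

text \<open>Relations among the rows are full-length vectors that vanish off \<open>J\<close>, so no
  reindexing by \<open>J\<close> is needed. Independence is that of the family of labelled rows: two
  equal rows with different labels in \<open>J\<close> are dependent.\<close>

definition rows_independent :: "real mat \<Rightarrow> nat set \<Rightarrow> bool" where
  "rows_independent A J \<longleftrightarrow>
     (\<forall>v\<in>carrier_vec (dim_row A).
        supported v J \<longrightarrow> A\<^sup>T *\<^sub>v v = 0\<^sub>v (dim_col A) \<longrightarrow> v = 0\<^sub>v (dim_row A))"

lemma pick_less: "J \<subseteq> {..<m} \<Longrightarrow> k < card J \<Longrightarrow> pick J k < (m::nat)"
  using pick_in_set_le[of k J] by auto

lemma pick_inj: "j < card J \<Longrightarrow> k < card J \<Longrightarrow> pick J j = pick J k \<longleftrightarrow> j = k"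
  by (metis card_pick_le)

lemma card_Collect_less_and: "J \<subseteq> {..<m} \<Longrightarrow> card {k. k < m \<and> k \<in> J} = card J"
  by (rule arg_cong[of _ _ card]) auto

lemma selection_carrier [simp]: "selection m J \<in> carrier_mat (card J) m"
  by (simp add: selection_def)

lemma selection_mult_vec:
  assumes "J \<subseteq> {..<m}" and "v \<in> carrier_vec m"
  shows "selection m J *\<^sub>v v = subvec v J"
proof (rule eq_vecI)
  show "dim_vec (selection m J *\<^sub>v v) = dim_vec (subvec v J)"
    using assms by (simp add: selection_def subvec_def card_Collect_less_and)
  fix k assume "k < dim_vec (subvec v J)"
  then have k: "k < card J"
    using assms by (simp add: subvec_def card_Collect_less_and)
  have "(selection m J *\<^sub>v v) $ k = (\<Sum>j<m. (if j = pick J k then 1 else 0) * v $ j)"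
    using k assms(2) by (simp add: selection_def scalar_prod_def lessThan_atLeast0)
  also have "\<dots> = v $ pick J k"
    using pick_less[OF assms(1) k] by (simp add: if_distrib[of "\<lambda>c. c * _"] sum.delta cong: if_cong)
  finally show "(selection m J *\<^sub>v v) $ k = subvec v J $ k"
    using k assms by (simp add: subvec_def card_Collect_less_and)
qed

lemma selection_mult_mat:
  assumes "J \<subseteq> {..<m}" and A: "A \<in> carrier_mat m n"
  shows "selection m J * A = row_submat A J"
proof (rule eq_matI)
  show d: "dim_row (selection m J * A) = dim_row (row_submat A J)"
    "dim_col (selection m J * A) = dim_col (row_submat A J)"
    using assms by (simp_all add: selection_def row_submat_def dim_submatrix card_Collect_less_and)
  fix k j assume "k < dim_row (row_submat A J)" "j < dim_col (row_submat A J)"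
  then have k: "k < card J" and j: "j < n"
    using assms d by (simp_all add: selection_def flip: d)
  have "(selection m J * A) $$ (k, j) = (selection m J *\<^sub>v col A j) $ k"
    using k j A by (simp add: selection_def)
  also have "\<dots> = A $$ (pick J k, j)"
    using A k j assms pick_less[OF assms(1) k]
    by (subst selection_mult_vec) (auto simp: subvec_def card_Collect_less_and)
  also have "\<dots> = row_submat A J $$ (k, j)"
    using k j assms
    by (simp add: row_submat_def submatrix_index card_Collect_less_and pick_UNIV)
  finally show "(selection m J * A) $$ (k, j) = row_submat A J $$ (k, j)" .
qed

text \<open>The number of elements of \<open>J\<close> below \<open>j\<close> is the position of
  \<open>j\<close> in \<open>J\<close>, counted from 0. It inverts \<open>pick J\<close>, so a
  single term of the sum survives when \<open>j\<close> lies in \<open>J\<close>, and none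
  otherwise.\<close>

lemma transpose_selection_mult_vec:
  assumes "J \<subseteq> {..<m}" and "w \<in> carrier_vec (card J)" and "j < m"
  shows "((selection m J)\<^sup>T *\<^sub>v w) $ j = (if j \<in> J then w $ card {a \<in> J. a < j} else 0)"
proof -
  have "((selection m J)\<^sup>T *\<^sub>v w) $ j = (\<Sum>k<card J. (if j = pick J k then w $ k else 0))"
    using assms(2,3)
    by (auto simp: selection_def scalar_prod_def lessThan_atLeast0 intro!: sum.cong)
  also have "\<dots> = (if j \<in> J then w $ card {a \<in> J. a < j} else 0)"
  proof (cases "j \<in> J")
    case True
    have "finite J"
      using assms(1) finite_subset by blast
    then have "card {a \<in> J. a < j} < card J"
      using True by (intro psubset_card_mono) auto
    moreover have "j = pick J k \<longleftrightarrow> k = card {a \<in> J. a < j}" if "k < card J" for k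
      using that True pick_card_in_set card_pick_le by metis
    ultimately have "(\<Sum>k<card J. if j = pick J k then w $ k else 0) =
        (\<Sum>k<card J. if k = card {a \<in> J. a < j} then w $ k else 0)"
      by (intro sum.cong) auto
    then show ?thesis
      using True \<open>card {a \<in> J. a < j} < card J\<close> by simp
  next
    case False
    then show ?thesis
      by (auto intro!: sum.neutral dest: pick_in_set_le)
  qed
  finally show ?thesis .
qed

lemma supported_transpose_selection:
  assumes "J \<subseteq> {..<m}" and "w \<in> carrier_vec (card J)"
  shows "supported ((selection m J)\<^sup>T *\<^sub>v w) J"
  unfolding supported_def
  using transpose_selection_mult_vec[OF assms] by (auto simp: selection_def)

lemma selection_transpose_selection:
  assumes "J \<subseteq> {..<m}"
  shows "selection m J * (selection m J)\<^sup>T = 1\<^sub>m (card J)"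
proof (rule eq_matI)
  fix k l assume "k < dim_row (1\<^sub>m (card J) :: real mat)" "l < dim_col (1\<^sub>m (card J) :: real mat)"
  then have kl: "k < card J" "l < card J"
    by simp_all
  \<comment> \<open>The product selects the rows labelled by \<open>J\<close> from the transpose of
    \<open>selection m J\<close>; row \<open>pick J k\<close> of that transpose is the
    \<open>k\<close>-th unit vector because \<open>pick J\<close> is injective.\<close>
  have S: "selection m J * (selection m J)\<^sup>T = row_submat ((selection m J)\<^sup>T) J"
    by (rule selection_mult_mat[OF assms, of _ "card J"]) (simp add: selection_def)
  show "(selection m J * (selection m J)\<^sup>T) $$ (k, l) = 1\<^sub>m (card J) $$ (k, l)"
    unfolding S using kl pick_less[OF assms] pick_inj[of k J l]
    by (simp add: row_submat_def submatrix_index selection_def card_Collect_less_and[OF assms] pick_UNIV)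
qed (simp_all add: selection_def)

text \<open>Selecting and then padding is the coordinate projection onto \<open>J\<close>, which
  fixes every vector supported in \<open>J\<close>.\<close>

lemma transpose_selection_selection:
  assumes "J \<subseteq> {..<m}" and "v \<in> carrier_vec m" and "supported v J"
  shows "(selection m J)\<^sup>T *\<^sub>v (selection m J *\<^sub>v v) = v"
proof (rule eq_vecI)
  show "dim_vec ((selection m J)\<^sup>T *\<^sub>v (selection m J *\<^sub>v v)) = dim_vec v"
    using assms by (simp add: selection_def)
  fix j assume "j < dim_vec v"
  then have j: "j < m"
    using assms by simp
  have "((selection m J)\<^sup>T *\<^sub>v (selection m J *\<^sub>v v)) $ j =
      (if j \<in> J then subvec v J $ card {a \<in> J. a < j} else 0)"
    using transpose_selection_mult_vec[OF assms(1) mult_mat_vec_carrier[OF selection_carrier assms(2)] j]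
    by (simp only: selection_mult_vec[OF assms(1,2)])
  also have "\<dots> = v $ j"
  proof (cases "j \<in> J")
    case True
    then have "card {a \<in> J. a < j} < card J"
      using finite_subset[OF assms(1)] by (intro psubset_card_mono) auto
    then show ?thesis
      using True assms by (simp add: subvec_def card_Collect_less_and pick_card_in_set)
  next
    case False
    then show ?thesis
      using j assms by (simp add: supported_def)
  qed
  finally show "((selection m J)\<^sup>T *\<^sub>v (selection m J *\<^sub>v v)) $ j = v $ j" .
qed

section \<open>Rank from a full rank factorization\<close>

lemma mat_rank_full_rank_factorization:
  assumes C: "C \<in> carrier_mat m k" and B: "B \<in> carrier_mat k n"
    and L: "L \<in> carrier_mat k m" and R: "R \<in> carrier_mat n k"
    and LC: "L * C = 1\<^sub>m k" and BR: "B * R = 1\<^sub>m k"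
  shows "mat_rank (C * B) = k"
proof -
  interpret vec_space "TYPE(real)" m .
  have C_inj: "v = 0\<^sub>v k" if v: "v \<in> carrier_vec k" and "C *\<^sub>v v = 0\<^sub>v m" for v
  proof -
    have "v = (L * C) *\<^sub>v v"
      using v LC by simp
    also have "\<dots> = 0\<^sub>v k"
      using that L by (auto simp: assoc_mult_mat_vec[OF L C v])
    finally show ?thesis .
  qed
  \<comment> \<open>\<open>lin_indpt\<close> speaks of the set of columns, so repeated columns have
    to be excluded separately: they would make two columns of \<open>L * C\<close>, an identity
    matrix, equal.\<close>
  have dist: "distinct (cols C)"
    unfolding distinct_conv_nth
  proof (intro allI impI)
    fix i j assume ij: "i < length (cols C)" "j < length (cols C)" "i \<noteq> j"
    then have "i < k" "j < k"
      using C by simp_all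
    show "cols C ! i \<noteq> cols C ! j"
    proof
      assume "cols C ! i = cols C ! j"
      then have "col C i = col C j"
        using ij by simp
      then have "col (L * C) i = col (L * C) j"
        using col_mult2[OF L C] \<open>i < k\<close> \<open>j < k\<close> by simp
      then have "unit_vec k i = (unit_vec k j :: real vec)"
        using LC \<open>i < k\<close> \<open>j < k\<close> by simp
      then have "unit_vec k i $ i = (unit_vec k j $ i :: real)"
        by simp
      then show False
        using \<open>i < k\<close> \<open>j < k\<close> \<open>i \<noteq> j\<close> by simp
    qed
  qed
  have "lin_indpt (set (cols C))"
    using lin_depE[OF C _ dist] C_inj by metis
  then have "rank C = k"
    using lin_indpt_full_rank[OF C dist] by simp
  moreover have "span (set (cols (C * B))) = span (set (cols C))"
  proof -
    have CB: "C * B \<in> carrier_mat m n"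
      using C B by simp
    have 1: "(C * B) *\<^sub>v x = C *\<^sub>v (B *\<^sub>v x)" if "x \<in> carrier_vec n" for x
      using C B that by simp
    \<comment> \<open>As \<open>z = B (R z)\<close>, the right inverse turns every combination of
      columns of \<open>C\<close> into one of columns of \<open>C * B\<close>.\<close>
    have 2: "C *\<^sub>v z = (C * B) *\<^sub>v (R *\<^sub>v z)" if z: "z \<in> carrier_vec k" for z
    proof -
      have "z = B *\<^sub>v (R *\<^sub>v z)"
        using assoc_mult_mat_vec[OF B R z] BR z by simp
      then show ?thesis
        using 1[of "R *\<^sub>v z"] R z by (metis mult_mat_vec_carrier)
    qed
    have "col_space (C * B) = col_space C"
      unfolding col_space_eq[OF CB] col_space_eq[OF C]
      using 1 2 C B R by (auto; metis mult_mat_vec_carrier)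
    then show ?thesis
      by (simp add: col_space_def)
  qed
  ultimately show ?thesis
    using C by (simp add: mat_rank_def rank_def)
qed

section \<open>Row submatrices and their Gram matrices\<close>

lemma row_submat_carrier:
  "J \<subseteq> {..<m} \<Longrightarrow> A \<in> carrier_mat m n \<Longrightarrow> row_submat A J \<in> carrier_mat (card J) n"
  using selection_mult_mat[of J m A n] by (metis mult_carrier_mat selection_carrier)

lemma transpose_row_submat_mult_vec:
  assumes "J \<subseteq> {..<m}" and "A \<in> carrier_mat m n" and "w \<in> carrier_vec (card J)"
  shows "(row_submat A J)\<^sup>T *\<^sub>v w = A\<^sup>T *\<^sub>v ((selection m J)\<^sup>T *\<^sub>v w)"
proof -
  have "(row_submat A J)\<^sup>T = A\<^sup>T * (selection m J)\<^sup>T"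
    using transpose_mult[OF selection_carrier[of m J] assms(2)]
    by (simp add: selection_mult_mat[OF assms(1,2)])
  then show ?thesis
    using assms assoc_mult_mat_vec[of "A\<^sup>T" n m "(selection m J)\<^sup>T" "card J" w]
    by simp
qed

text \<open>If \<open>B B^T w = 0\<close>, then \<open>B^T w\<close> has squared norm 0 and hence
  vanishes. Padding \<open>w\<close> with zeros then gives a relation among the rows in
  \<open>J\<close>, which independence forces to be trivial.\<close>

lemma mat_inverse_gram:
  assumes J: "J \<subseteq> {..<m}" and A: "A \<in> carrier_mat m n" and ind: "rows_independent A J"
  defines "B \<equiv> row_submat A J"
  obtains G where "mat_inverse (B * B\<^sup>T) = Some G" and "G \<in> carrier_mat (card J) (card J)"
    and "G * (B * B\<^sup>T) = 1\<^sub>m (card J)" and "(B * B\<^sup>T) * G = 1\<^sub>m (card J)"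
proof -
  let ?k = "card J"
  have B: "B \<in> carrier_mat ?k n"
    unfolding B_def using J A by (rule row_submat_carrier)
  have G: "B * B\<^sup>T \<in> carrier_mat ?k ?k"
    using B by simp
  have "det (B * B\<^sup>T) \<noteq> 0"
  proof
    assume "det (B * B\<^sup>T) = 0"
    then obtain w where w: "w \<in> carrier_vec ?k" "w \<noteq> 0\<^sub>v ?k" "(B * B\<^sup>T) *\<^sub>v w = 0\<^sub>v ?k"
      using det_0_iff_vec_prod_zero_field[OF G] by blast
    define u where "u = B\<^sup>T *\<^sub>v w"
    have u: "u \<in> carrier_vec n"
      using B w by (simp add: u_def)
    have "scalar_prod u u = scalar_prod (B *\<^sub>v u) w"
      using transpose_vec_mult_scalar[OF B u w(1)] comm_scalar_prod[OF u u] B u w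
      unfolding u_def by (metis comm_scalar_prod mult_mat_vec_carrier)
    also have "B *\<^sub>v u = 0\<^sub>v ?k"
      using w B by (simp add: u_def)
    finally have "scalar_prod u u = 0"
      using w by simp
    then have "u = 0\<^sub>v n"
      using conjugate_square_eq_0_vec[OF u] by simp
    let ?v = "(selection m J)\<^sup>T *\<^sub>v w"
    have v: "?v \<in> carrier_vec m"
      using w by (metis mult_mat_vec_carrier selection_carrier transpose_carrier_mat)
    have "A\<^sup>T *\<^sub>v ?v = 0\<^sub>v n"
      using \<open>u = 0\<^sub>v n\<close> transpose_row_submat_mult_vec[OF J A w(1)] by (simp add: u_def B_def)
    then have "?v = 0\<^sub>v m"
      using ind v A supported_transpose_selection[OF J w(1)] by (simp add: rows_independent_def)
    \<comment> \<open>Padding is injective, with selection as left inverse, so \<open>w\<close>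
      vanishes along with its padded version.\<close>
    have "w = (selection m J * (selection m J)\<^sup>T) *\<^sub>v w"
      using w by (simp add: selection_transpose_selection[OF J])
    also have "\<dots> = selection m J *\<^sub>v ?v"
      by (rule assoc_mult_mat_vec[of _ ?k m]) (use w in simp_all)
    also have "\<dots> = 0\<^sub>v ?k"
      using \<open>?v = 0\<^sub>v m\<close> by (auto simp: selection_def)
    finally show False
      using w by simp
  qed
  then have "B * B\<^sup>T \<in> Units (ring_mat TYPE(real) ?k ())"
    by (rule det_non_zero_imp_unit[OF G])
  then obtain H where "mat_inverse (B * B\<^sup>T) = Some H"
    using mat_inverse(1)[OF G, of "()"] by (cases "mat_inverse (B * B\<^sup>T)") auto
  then show ?thesis
    using that mat_inverse(2)[OF G] by blast
qed

section \<open>Extending independent rows to a row basis\<close>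

text \<open>Take \<open>J\<close> maximal among the independent label sets containing
  \<open>S\<close>. Its rows \<open>B\<close> span all rows of \<open>A\<close>, so
  \<open>A = C * B\<close> with a coefficient matrix \<open>C\<close>, and the factorization lemma
  gives both ranks as \<open>card J\<close>.\<close>

lemma extend_to_row_basis:
  assumes A: "A \<in> carrier_mat m n" and S: "S \<subseteq> {..<m}" and ind: "rows_independent A S"
  obtains J where "S \<subseteq> J" and "J \<subseteq> {..<m}" and "rows_independent A J"
    and "card J = mat_rank A" and "mat_rank (row_submat A J) = mat_rank A"
proof -
  obtain J where max: "maximal J (\<lambda>T. T \<subseteq> {..<m} \<and> rows_independent A T)" and SJ: "S \<subseteq> J"
    using maximal_exists_superset[of "{..<m}" "\<lambda>T. T \<subseteq> {..<m} \<and> rows_independent A T" S]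
      S ind by auto
  then have J: "J \<subseteq> {..<m}" and indJ: "rows_independent A J"
    by (auto simp: maximal_def)
  let ?k = "card J" and ?L = "selection m J"
  define B where "B = row_submat A J"
  have B: "B \<in> carrier_mat ?k n"
    unfolding B_def using J A by (rule row_submat_carrier)
  have "\<exists>c\<in>carrier_vec ?k. B\<^sup>T *\<^sub>v c = row A i" if i: "i < m" for i
  proof -
    have row: "A\<^sup>T *\<^sub>v unit_vec m i = row A i"
      using A i by (intro eq_vecI) (auto simp: scalar_prod_right_unit)
    have "\<exists>u\<in>carrier_vec m. supported u J \<and> A\<^sup>T *\<^sub>v u = row A i"
    proof (cases "i \<in> J")
      case True
      then show ?thesis
        using row i by (intro bexI[of _ "unit_vec m i"]) (auto simp: supported_def)
    next
      case False
      have "\<not> rows_independent A (insert i J)"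
        using max False i J unfolding maximal_def by blast
      then obtain v where v: "v \<in> carrier_vec m" "supported v (insert i J)"
          "A\<^sup>T *\<^sub>v v = 0\<^sub>v n" "v \<noteq> 0\<^sub>v m"
        using A by (auto simp: rows_independent_def)
      \<comment> \<open>Otherwise \<open>v\<close> would be a nontrivial relation among the rows in
        \<open>J\<close> alone.\<close>
      have "v $ i \<noteq> 0"
      proof
        assume "v $ i = 0"
        then have "supported v J"
          using v by (auto simp: supported_def)
        then show False
          using v indJ A by (auto simp: rows_independent_def)
      qed
      \<comment> \<open>The multiple of \<open>v\<close> cancels the coordinate at \<open>i\<close>
        without changing the image under the transpose of \<open>A\<close>, so row \<open>i\<close>
        becomes a combination of rows in \<open>J\<close>.\<close>
      define u where "u = unit_vec m i - (1 / v $ i) \<cdot>\<^sub>v v"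
      have "A\<^sup>T *\<^sub>v u = row A i"
        unfolding u_def using A v
        by (subst mult_minus_distrib_mat_vec[of _ n m])
          (auto simp: row mult_mat_vec[of _ n m])
      moreover have "supported u J"
        using v i \<open>v $ i \<noteq> 0\<close> by (auto simp: u_def supported_def)
      ultimately show ?thesis
        using v by (intro bexI[of _ u]) (auto simp: u_def)
    qed
    then obtain u where u: "u \<in> carrier_vec m" "supported u J" "A\<^sup>T *\<^sub>v u = row A i"
      by blast
    have Lu: "?L *\<^sub>v u \<in> carrier_vec ?k"
      using u by (metis mult_mat_vec_carrier selection_carrier)
    show ?thesis
      using transpose_row_submat_mult_vec[OF J A Lu] transpose_selection_selection[OF J u(1,2)] u Lu
      by (auto simp: B_def)
  qed
  then obtain c where c: "\<And>i. i < m \<Longrightarrow> c i \<in> carrier_vec ?k \<and> B\<^sup>T *\<^sub>v c i = row A i"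
    by metis
  define C where "C = mat m ?k (\<lambda>(i, j). c i $ j)"
  have C: "C \<in> carrier_mat m ?k"
    by (simp add: C_def)
  have CB: "C * B = A"
  proof (rule eq_matI)
    fix i j assume "i < dim_row A" "j < dim_col A"
    then have ij: "i < m" "j < n"
      using A by simp_all
    have "row C i = c i"
      using c[OF ij(1)] ij by (intro eq_vecI) (auto simp: C_def)
    then have "(C * B) $$ (i, j) = scalar_prod (c i) (col B j)"
      using ij C B by simp
    also have "\<dots> = scalar_prod (col B j) (c i)"
      using B c[OF ij(1)] by (intro comm_scalar_prod[of _ ?k] carrier_vecI) simp_all
    also have "\<dots> = (B\<^sup>T *\<^sub>v c i) $ j"
      using ij B by simp
    also have "\<dots> = A $$ (i, j)"
      using c[OF ij(1)] ij A by simp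
    finally show "(C * B) $$ (i, j) = A $$ (i, j)" .
  qed (use A B C in simp_all)
  obtain G where G: "G \<in> carrier_mat ?k ?k" "(B * B\<^sup>T) * G = 1\<^sub>m ?k"
    using mat_inverse_gram[OF J A indJ] unfolding B_def by metis
  \<comment> \<open>The Moore-Penrose right inverse of \<open>B\<close>, available because the Gram
    matrix is invertible.\<close>
  define R where "R = B\<^sup>T * G"
  have R: "R \<in> carrier_mat n ?k"
    using B G by (simp add: R_def)
  have BR: "B * R = 1\<^sub>m ?k"
    using G(2) assoc_mult_mat[OF B _ G(1), of "B\<^sup>T"] B unfolding R_def by simp
  \<comment> \<open>The left inverse of \<open>C\<close> comes from cancelling \<open>B\<close> on
    the right: selecting the rows \<open>J\<close> in \<open>C * B = A\<close> gives
    \<open>?L * C * B = B\<close>, and \<open>B * R\<close> is the identity.\<close>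
  have "?L * C = (?L * C) * (B * R)"
    using BR C by simp
  also have "\<dots> = (?L * (C * B)) * R"
    using assoc_mult_mat[OF mult_carrier_mat[OF selection_carrier C] B R]
      assoc_mult_mat[OF selection_carrier C B] by metis
  also have "\<dots> = 1\<^sub>m ?k"
    unfolding CB selection_mult_mat[OF J A] using BR by (simp add: B_def)
  finally have LC: "?L * C = 1\<^sub>m ?k" .
  have "mat_rank A = ?k"
    using mat_rank_full_rank_factorization[OF C B selection_carrier R LC BR] CB by simp
  \<comment> \<open>The same factorization lemma with the identity as left factor.\<close>
  moreover have "mat_rank B = ?k"
    using mat_rank_full_rank_factorization[of "1\<^sub>m ?k" ?k ?k B n "1\<^sub>m ?k" R] B R BR by simp
  ultimately show ?thesis
    using that[OF SJ J indJ] by (simp add: B_def)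
qed

section \<open>Caratheodory reduction of multipliers\<close>

text \<open>Moving from a multiplier with dependent support along a dependency relation until the
  first coordinate vanishes makes the support strictly smaller.\<close>

lemma conic_caratheodory:
  assumes A: "A \<in> carrier_mat m n"
    and "l \<in> carrier_vec m" and "0\<^sub>v m \<le> l" and "A\<^sup>T *\<^sub>v l = g" and "supported l Z"
  shows "\<exists>l'\<in>carrier_vec m. 0\<^sub>v m \<le> l' \<and> A\<^sup>T *\<^sub>v l' = g \<and> supported l' Z \<and>
    rows_independent A {i. i < m \<and> l' $ i \<noteq> 0}"
  using assms(2-)
proof (induction "card {i. i < m \<and> l $ i \<noteq> 0}" arbitrary: l rule: less_induct)
  case less
  let ?S = "\<lambda>l. {i. i < m \<and> l $ i \<noteq> 0}"
  have l0: "l $ i \<ge> 0" if "i < m" for i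
    using less.prems that by (auto simp: less_eq_vec_def)
  show ?case
  proof (cases "rows_independent A (?S l)")
    case True
    then show ?thesis
      using less.prems by blast
  next
    case False
    then obtain v where v: "v \<in> carrier_vec m" "supported v (?S l)" "A\<^sup>T *\<^sub>v v = 0\<^sub>v n"
        "v \<noteq> 0\<^sub>v m"
      using A by (auto simp: rows_independent_def)
    obtain i where i: "i < m" "v $ i \<noteq> 0"
      using v by (metis carrier_vecD eq_vecI index_zero_vec)
    \<comment> \<open>The sign makes some coordinate of the relation positive, so that the minimum
      defining \<open>t\<close> ranges over a nonempty set.\<close>
    define u where "u = sgn (v $ i) \<cdot>\<^sub>v v"
    have u: "u \<in> carrier_vec m" "A\<^sup>T *\<^sub>v u = 0\<^sub>v n" "u $ i > 0"
      using v i A mult_mat_vec[of "A\<^sup>T" n m v] by (auto simp: u_def sgn_if)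
    have uS: "u $ j = 0" if "j < m" "l $ j = 0" for j
      using v that by (auto simp: u_def supported_def)
    let ?P = "{j. j < m \<and> u $ j > 0}"
    \<comment> \<open>The largest step for which \<open>l - t u\<close> stays nonnegative; the
      coordinate \<open>p\<close> attaining the minimum becomes 0.\<close>
    define t where "t = Min ((\<lambda>j. l $ j / u $ j) ` ?P)"
    have "t \<in> (\<lambda>j. l $ j / u $ j) ` ?P"
      unfolding t_def using i u by (intro Min_in) auto
    then obtain p where p: "p < m" "u $ p > 0" "t = l $ p / u $ p"
      by auto
    have t_le: "t \<le> l $ j / u $ j" if "j < m" "u $ j > 0" for j
      unfolding t_def using that by (intro Min_le) auto
    have "t \<ge> 0"
      using p l0 by simp
    define l' where "l' = l - t \<cdot>\<^sub>v u"
    have l': "l' \<in> carrier_vec m"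
      using less.prems u by (simp add: l'_def)
    have l'_ix: "l' $ j = l $ j - t * u $ j" if "j < m" for j
      using that u less.prems by (simp add: l'_def)
    have l'0: "l' $ j \<ge> 0" if j: "j < m" for j
    proof (cases "u $ j > 0")
      case True
      then show ?thesis
        using t_le[OF j] j by (simp add: l'_ix field_simps)
    next
      case False
      then have "t * u $ j \<le> 0"
        using \<open>t \<ge> 0\<close> by (simp add: mult_nonneg_nonpos)
      then show ?thesis
        using l0[OF j] j by (simp add: l'_ix)
    qed
    \<comment> \<open>The relation vanishes off the support of \<open>l\<close>, so no new
      coordinate becomes nonzero, while \<open>p\<close> drops out.\<close>
    have "?S l' \<subseteq> ?S l"
      using uS l'_ix by auto
    moreover have "p \<in> ?S l" "p \<notin> ?S l'"
      using p uS[of p] l'_ix[of p] by auto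
    ultimately have "card (?S l') < card (?S l)"
      by (intro psubset_card_mono) auto
    moreover have "0\<^sub>v m \<le> l'"
      using l'0 l' by (auto simp: less_eq_vec_def)
    moreover have "A\<^sup>T *\<^sub>v l' = g"
      using less.prems A u
      by (auto simp: l'_def mult_minus_distrib_mat_vec[of _ n m] mult_mat_vec[of _ n m])
    \<comment> \<open>In the application \<open>Z\<close> is the set of active constraints, so this
      preserves complementarity.\<close>
    moreover have "supported l' Z"
      using less.prems \<open>?S l' \<subseteq> ?S l\<close> l' by (fastforce simp: supported_def)
    ultimately show ?thesis
      using less.hyps[OF _ l'] by blast
  qed
qed

section \<open>Multipliers of a single player\<close>

text \<open>A sum of nonnegative products is 0 exactly when each product is 0.\<close>

lemma complementary_iff:
  assumes "u \<in> carrier_vec m" "v \<in> carrier_vec m"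
  shows "complementary u v \<longleftrightarrow> 0\<^sub>v m \<le> u \<and> 0\<^sub>v m \<le> v \<and> (\<forall>i<m. u $ i = 0 \<or> v $ i = 0)"
proof (cases "0\<^sub>v m \<le> u \<and> 0\<^sub>v m \<le> v")
  case True
  then have "scalar_prod u v = 0 \<longleftrightarrow> (\<forall>i\<in>{0..<m}. u $ i * v $ i = 0)"
    using assms unfolding scalar_prod_def
    by (subst sum_nonneg_eq_0_iff) (auto simp: less_eq_vec_def)
  then show ?thesis
    using True assms by (auto simp: complementary_def)
qed (use assms in \<open>auto simp: complementary_def\<close>)

text \<open>The theorem for one player at a fixed feasible point: \<open>g\<close> stands for the
  gradient and \<open>c\<close> for the constraint values, which leaves pure linear algebra.\<close>

lemma multiplier_iff_partial_multiplier:
  assumes A: "A \<in> carrier_mat m n" and g: "g \<in> carrier_vec n" and c: "c \<in> carrier_vec m"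
    and c0: "0\<^sub>v m \<le> c"
  shows "(\<exists>l\<in>carrier_vec m. g - A\<^sup>T *\<^sub>v l = 0\<^sub>v n \<and> complementary l c) \<longleftrightarrow>
    (\<exists>J. J \<subseteq> {..<m} \<and> card J = mat_rank A \<and> mat_rank (row_submat A J) = mat_rank A \<and>
      (let B = row_submat A J; w = the (mat_inverse (B * B\<^sup>T)) *\<^sub>v (B *\<^sub>v g)
       in g - B\<^sup>T *\<^sub>v w = 0\<^sub>v n \<and> complementary w (subvec c J)))"
    (is "?L \<longleftrightarrow> (\<exists>J. ?R J)")
proof
  assume ?L
  then obtain l where l: "l \<in> carrier_vec m" "g - A\<^sup>T *\<^sub>v l = 0\<^sub>v n" "complementary l c"
    by blast
  have "A\<^sup>T *\<^sub>v l = g"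
    using l A g by (intro eq_vecI) (auto simp: vec_eq_iff)
  moreover have "0\<^sub>v m \<le> l" "supported l {i. c $ i = 0}"
    using l c by (auto simp: complementary_iff[OF l(1) c] supported_def)
  ultimately obtain l' where l': "l' \<in> carrier_vec m" "0\<^sub>v m \<le> l'" "A\<^sup>T *\<^sub>v l' = g"
      "supported l' {i. c $ i = 0}" "rows_independent A {i. i < m \<and> l' $ i \<noteq> 0}"
    using conic_caratheodory[OF A l(1)] by metis
  obtain J where J: "{i. i < m \<and> l' $ i \<noteq> 0} \<subseteq> J" "J \<subseteq> {..<m}" "rows_independent A J"
      "card J = mat_rank A" "mat_rank (row_submat A J) = mat_rank A"
    using extend_to_row_basis[OF A _ l'(5)] by blast
  define B where "B = row_submat A J"
  define w where "w = selection m J *\<^sub>v l'"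
  have B: "B \<in> carrier_mat (card J) n"
    unfolding B_def using J(2) A by (rule row_submat_carrier)
  have w: "w \<in> carrier_vec (card J)"
    using l' unfolding w_def by (metis mult_mat_vec_carrier selection_carrier)
  have "supported l' J"
    using J(1) l'(1) by (auto simp: supported_def)
  then have Bw: "B\<^sup>T *\<^sub>v w = g"
    using transpose_row_submat_mult_vec[OF J(2) A w] l'(1,3)
      transpose_selection_selection[OF J(2) l'(1)] by (simp add: B_def w_def)
  obtain G where G: "mat_inverse (B * B\<^sup>T) = Some G" "G \<in> carrier_mat (card J) (card J)"
      "G * (B * B\<^sup>T) = 1\<^sub>m (card J)"
    using mat_inverse_gram[OF J(2) A J(3)] unfolding B_def by metis
  \<comment> \<open>Substituting \<open>g = B^T w\<close> recovers \<open>w\<close>, so any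
    representation of \<open>g\<close> by the rows in \<open>J\<close> is the partial multiplier
    expression.\<close>
  have "G *\<^sub>v (B *\<^sub>v g) = (G * (B * B\<^sup>T)) *\<^sub>v w"
  proof -
    have "B * B\<^sup>T \<in> carrier_mat (card J) (card J)"
      using B by simp
    then show ?thesis
      using B w assoc_mult_mat_vec[OF G(2) _ w] assoc_mult_mat_vec[of B "card J" n "B\<^sup>T" "card J" w]
      by (simp flip: Bw)
  qed
  then have Gw: "the (mat_inverse (B * B\<^sup>T)) *\<^sub>v (B *\<^sub>v g) = w"
    using G w by simp
  have sc: "subvec c J \<in> carrier_vec (card J)"
    using c J(2) by (simp add: subvec_def card_Collect_less_and)
  have "complementary w (subvec c J)"
    unfolding complementary_iff[OF w sc]
    using l' c c0 pick_less[OF J(2)]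
    by (auto simp: w_def selection_mult_vec[OF J(2) l'(1)] subvec_def
        card_Collect_less_and[OF J(2)] less_eq_vec_def supported_def)
  then show "\<exists>J. ?R J"
    using J g Bw Gw by (intro exI[of _ J]) (simp add: Let_def flip: B_def)
next
  assume "\<exists>J. ?R J"
  then obtain J w where J: "J \<subseteq> {..<m}" and eq: "g - (row_submat A J)\<^sup>T *\<^sub>v w = 0\<^sub>v n"
    and comp: "complementary w (subvec c J)"
    by (auto simp: Let_def)
  have sc: "subvec c J \<in> carrier_vec (card J)"
    using c J by (simp add: subvec_def card_Collect_less_and)
  \<comment> \<open>The dimension of \<open>w\<close> is read off from complementarity, since the
    order on vectors includes equality of dimensions; invertibility of the Gram matrix is not
    established in this direction.\<close>
  then have w: "w \<in> carrier_vec (card J)"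
    using comp by (auto simp: complementary_def less_eq_vec_def intro: carrier_vecI)
  define l where "l = (selection m J)\<^sup>T *\<^sub>v w"
  have l: "l \<in> carrier_vec m"
    using w unfolding l_def by (metis mult_mat_vec_carrier selection_carrier transpose_carrier_mat)
  have ix: "card {a \<in> J. a < j} < card J" if "j \<in> J" for j
    using that finite_subset[OF J] by (intro psubset_card_mono) auto
  have "w $ k \<ge> 0 \<and> (w $ k = 0 \<or> c $ pick J k = 0)" if "k < card J" for k
    using comp[unfolded complementary_iff[OF w sc]] that w c J
    by (auto simp: less_eq_vec_def subvec_def card_Collect_less_and)
  \<comment> \<open>At \<open>j\<close> in \<open>J\<close> the padded vector has the entry of
    \<open>w\<close> at the position of \<open>j\<close>; elsewhere it is 0, and there
    \<open>c0\<close> supplies the sign of the constraint.\<close>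
  then have "\<forall>j<m. 0 \<le> l $ j \<and> (l $ j = 0 \<or> c $ j = 0)"
    using ix pick_card_in_set
    unfolding l_def by (metis (lifting) order_refl transpose_selection_mult_vec[OF J w])
  then have "complementary l c"
    using c0 l by (auto simp: complementary_iff[OF l c] less_eq_vec_def)
  moreover have "g - A\<^sup>T *\<^sub>v l = 0\<^sub>v n"
    using eq transpose_row_submat_mult_vec[OF J A w] by (simp add: l_def)
  ultimately show ?L
    using l by blast
qed

section \<open>Assembling the players\<close>

lemma partial_constraint_vec_eq_subvec:
  assumes A: "A i \<in> carrier_mat m n" and b: "b i \<in> carrier_vec m" and x: "x i \<in> carrier_vec n"
    and J: "J \<subseteq> {..<m}"
  shows "partial_constraint_vec A b i J x = subvec (constraint_vec A b i x) J"
proof -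
  have "row_submat (A i) J *\<^sub>v x i = selection m J *\<^sub>v (A i *\<^sub>v x i)"
    using assoc_mult_mat_vec[OF selection_carrier[of m J] A x] by (simp add: selection_mult_mat[OF J A])
  also have "\<dots> = subvec (A i *\<^sub>v x i) J"
    using A x by (intro selection_mult_vec[OF J]) simp
  finally show ?thesis
    unfolding partial_constraint_vec_def constraint_vec_def
    using A b pick_less[OF J]
    by (intro eq_vecI) (auto simp: subvec_def card_Collect_less_and[OF J])
qed

theorem theorem3p4:
  fixes N :: nat
    and n m :: "nat \<Rightarrow> nat"
    and f :: "nat \<Rightarrow> real_mpoly"
    and A :: "nat \<Rightarrow> real mat"
    and b :: "nat \<Rightarrow> real_mpoly vec"
  assumes f: "\<And>i. i < N \<Longrightarrow> poly_vars (f i) \<subseteq> block_vars {..<N} n"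
    and A: "\<And>i. i < N \<Longrightarrow> A i \<in> carrier_mat (m i) (n i)"
    and b: "\<And>i. i < N \<Longrightarrow> b i \<in> carrier_vec (m i)"
    and b_vars: "\<And>i k. i < N \<Longrightarrow> k < m i \<Longrightarrow> poly_vars (b i $ k) \<subseteq> block_vars ({..<N} - {i}) n"
  shows "KKT_set N n m f A b = (\<Union>J\<in>row_basis_tuples N m A. partial_KKT_set N n m f A b J)"
proof -
  define Q where "Q x i l \<longleftrightarrow> l \<in> carrier_vec (m i) \<and>
      block_gradient i (n i) (f i) x - (A i)\<^sup>T *\<^sub>v l = 0\<^sub>v (n i) \<and>
      complementary l (constraint_vec A b i x)" for x i l
  define P where "P x i J \<longleftrightarrow>
      block_gradient i (n i) (f i) x
        - (row_submat (A i) J)\<^sup>T *\<^sub>v partial_LME n f A i J x = 0\<^sub>v (n i) \<and>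
      complementary (partial_LME n f A i J x) (partial_constraint_vec A b i J x)" for x i J
  \<comment> \<open>For a fixed feasible point the conditions decouple over the players.\<close>
  have player: "(\<exists>l. Q x i l) \<longleftrightarrow> (\<exists>J\<in>row_bases m A i. P x i J)"
    if x: "x \<in> feasible_set N n m A b" and i: "i < N" for x i
  proof -
    have xi: "x i \<in> carrier_vec (n i)" and c0: "0\<^sub>v (m i) \<le> constraint_vec A b i x"
      using x i by (auto simp: feasible_set_def profiles_def)
    have "constraint_vec A b i x \<in> carrier_vec (m i)"
      using b[OF i] by (intro carrier_vecI) (simp add: constraint_vec_def)
    from multiplier_iff_partial_multiplier[OF A[OF i] _ this c0, of "block_gradient i (n i) (f i) x"]
    show ?thesis
      using partial_constraint_vec_eq_subvec[of A i "m i" "n i" b x, OF A[OF i] b[OF i] xi]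
      by (auto simp: Q_def P_def row_bases_def partial_LME_def Let_def block_gradient_def)
  qed
  have KKT: "x \<in> KKT_set N n m f A b \<longleftrightarrow> x \<in> feasible_set N n m A b \<and> (\<forall>i<N. \<exists>l. Q x i l)" for x
    unfolding KKT_set_def Q_def[symmetric] by (auto intro: choice)
  have partial: "x \<in> (\<Union>J\<in>row_basis_tuples N m A. partial_KKT_set N n m f A b J) \<longleftrightarrow>
      x \<in> feasible_set N n m A b \<and> (\<forall>i<N. \<exists>J\<in>row_bases m A i. P x i J)" for x
  proof
    assume *: "x \<in> feasible_set N n m A b \<and> (\<forall>i<N. \<exists>J\<in>row_bases m A i. P x i J)"
    then obtain J where J: "\<And>i. i < N \<Longrightarrow> J i \<in> row_bases m A i \<and> P x i (J i)"
      by metis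
    \<comment> \<open>Tuples of row bases are extensional, so the choice function is made
      \<open>undefined\<close> from \<open>N\<close> on.\<close>
    then have "restrict J {..<N} \<in> row_basis_tuples N m A"
      by (auto simp: row_basis_tuples_def)
    moreover have "x \<in> partial_KKT_set N n m f A b (restrict J {..<N})"
      using * J by (simp add: partial_KKT_set_def P_def)
    ultimately show "x \<in> (\<Union>J\<in>row_basis_tuples N m A. partial_KKT_set N n m f A b J)"
      by blast
  qed (auto simp: partial_KKT_set_def row_basis_tuples_def P_def)
  show ?thesis
  proof (rule Set.set_eqI)
    show "x \<in> KKT_set N n m f A b \<longleftrightarrow>
        x \<in> (\<Union>J\<in>row_basis_tuples N m A. partial_KKT_set N n m f A b J)" for x
      unfolding KKT partial using player[of x] by metis
  qed
qed

end
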